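(* No universal rendezvous algorithm can have better time complexity than $\Theta(\max(W(v_1,v_2),\log L))$, where $v_1,v_2$ are the starting nodes of the agents and the labels of the agents are drawn from the set $\{1,\dots,L\}$.
   Context: Graphs. A graph is undirected, possibly infinite, with every node of finite or countably infinite degree; self-loops and multiple edges are allowed. Connected means that every pair of nodes is joined by at least one finite path. Ports at a node of finite degree $d$ are arbitrarily numbered $1,\dots,d$; ports at a node of infinite degree are arbitrarily numbered by all distinct positive integers. Nodes are anonymous (no labels are assumed) and cannot be marked. Rendezvous. Two agents start at distinct nodes $v_1,v_2$ and have distinct labels $\ell_1,\ell_2$ drawn from the set $\{1,\dots,L\}$; an instance is the set $\{(v_1,\ell_1),(v_2,\ell_2)\}$. Each agent knows a priori only its own label. Both execute the same deterministic algorithm with the agent's own label as a parameter, and have unbounded memory. Agents move in synchronous rounds: in each round, each agent either stays idle at the current node or chooses a port at the current node and traverses the corresponding edge; on entering a node it learns the entry port number. The agents have to meet at some node; if they cross each other, traversing simultaneously the same edge in opposite directions, they do not notice this fact. Agents are woken up in possibly different rounds by an adversary; before its wakeup an agent is idle at its starting node, where it can be met by the other agent. The time of a rendezvous algorithm is the worst-case number of rounds since the wakeup of the earlier agent until the meeting. A universal rendezvous algorithm is an algorithm that solves the rendezvous problem for every instance on every connected graph. Weight. A path from $u$ to $v$ is a finite sequence $\pi=(p_1,\dots,p_\delta)$ of port numbers such that taking port $p_1$ at $u$ and then ports $p_2,\dots,p_\delta$ at the subsequent nodes reaches $v$. Its type is $(m,\delta)$ with $m=\max(p_1,\dots,p_\delta)$,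 and the value of a pair $(x,y)$ of natural numbers is $y\,2^y x^y$. The weight $w(u,v)$ of an ordered couple of nodes is the smallest value of the type of any path from $u$ to $v$ (in general $w(u,v)$ need not equal $w(v,u)$). Finally, $W(v_1,v_2)=\max(w(v_1,v_2),w(v_2,v_1))$. *)

theory Defs
  imports Complex_Main "HOL-Library.Extended_Nat" "HOL-Library.Extended_Real"
begin

text \<open>
  The edge leaving \<open>v\<close> through port \<open>p\<close> arrives at \<open>u\<close> through port \<open>q\<close> iff
  \<open>rot G v p = (u, q)\<close>. An undirected edge is thus a pair of distinct matched half-edges
  \<open>(v, p)\<close>, \<open>(u, q)\<close>; a self-loop has \<open>u = v\<close> and occupies two different ports of \<open>v\<close>, and
  parallel edges are matched pairs with the same two nodes.
\<close>

record 'v port_graph =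
  nodes :: "'v set"
  degree :: "'v \<Rightarrow> enat"
  rot :: "'v \<Rightarrow> nat \<Rightarrow> 'v \<times> nat"

definition ports :: "'v port_graph \<Rightarrow> 'v \<Rightarrow> nat set" where
  "ports G v = {p. 1 \<le> p \<and> enat p \<le> degree G v}"

definition is_port_graph :: "'v port_graph \<Rightarrow> bool" where
  "is_port_graph G \<longleftrightarrow>
     (\<forall>v \<in> nodes G. \<forall>p \<in> ports G v. \<exists>u q.
        rot G v p = (u, q) \<and> u \<in> nodes G \<and> q \<in> ports G u \<and>
        (u, q) \<noteq> (v, p) \<and> rot G u q = (v, p))"

primrec is_path :: "'v port_graph \<Rightarrow> 'v \<Rightarrow> nat list \<Rightarrow> 'v \<Rightarrow> bool" where
  "is_path G u [] v \<longleftrightarrow> u = v"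
| "is_path G u (p # ps) v \<longleftrightarrow> p \<in> ports G u \<and> is_path G (fst (rot G u p)) ps v"

definition connected_port_graph :: "'v port_graph \<Rightarrow> bool" where
  "connected_port_graph G \<longleftrightarrow>
     is_port_graph G \<and> (\<forall>u \<in> nodes G. \<forall>v \<in> nodes G. \<exists>\<pi>. is_path G u \<pi> v)"

text \<open>The empty path only joins a node to itself; its value is \<open>0\<close>, whatever \<open>Max {}\<close> is.\<close>

definition path_type :: "nat list \<Rightarrow> nat \<times> nat" where
  "path_type \<pi> = (Max (set \<pi>), length \<pi>)"

definition type_value :: "nat \<times> nat \<Rightarrow> nat" where
  "type_value = (\<lambda>(x, y). y * 2 ^ y * x ^ y)"

definition weight :: "'v port_graph \<Rightarrow> 'v \<Rightarrow> 'v \<Rightarrow> nat" where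
  "weight G u v = (LEAST k. \<exists>\<pi>. is_path G u \<pi> v \<and> k = type_value (path_type \<pi>))"

definition pair_weight :: "'v port_graph \<Rightarrow> 'v \<Rightarrow> 'v \<Rightarrow> nat" where
  "pair_weight G v1 v2 = max (weight G v1 v2) (weight G v2 v1)"

datatype action = Stay | Take nat

text \<open>
  What an agent perceives at the end of a round: the port through which it has just entered the
  current node (\<open>None\<close> at wakeup and after staying idle) and the degree of that node, i.e. which
  ports it may choose from. A history lists all percepts since wakeup, oldest first; its length
  reveals the number of rounds elapsed. An algorithm maps the agent's own label and its history
  to the next action; no computability is demanded.
\<close>

type_synonym percept = "nat option \<times> enat"
type_synonym algorithm = "nat \<Rightarrow> percept list \<Rightarrow> action"

definition chooses_ports :: "algorithm \<Rightarrow> bool" where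
  "chooses_ports A \<longleftrightarrow>
     (\<forall>l h p. h \<noteq> [] \<longrightarrow> A l h = Take p \<longrightarrow> 1 \<le> p \<and> enat p \<le> snd (last h))"

primrec run :: "algorithm \<Rightarrow> 'v port_graph \<Rightarrow> 'v \<times> nat \<Rightarrow> nat \<Rightarrow> percept list \<times> 'v" where
  "run A G a 0 = ([(None, degree G (fst a))], fst a)"
| "run A G a (Suc t) =
     (let (h, u) = run A G a t in
        case A (snd a) h of
          Stay \<Rightarrow> (h @ [(None, degree G u)], u)
        | Take p \<Rightarrow> (let (u', q) = rot G u p in (h @ [(Some q, degree G u')], u')))"

text \<open>
  Node occupied at global time \<open>r\<close> by the agent \<open>a\<close> (starting node, label) woken up at
  time \<open>\<tau>\<close>. Truncated subtraction keeps the agent at its starting node before its wakeup.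
\<close>

definition position :: "algorithm \<Rightarrow> 'v port_graph \<Rightarrow> 'v \<times> nat \<Rightarrow> nat \<Rightarrow> nat \<Rightarrow> 'v" where
  "position A G a \<tau> r = snd (run A G a (r - \<tau>))"

definition meet_at ::
  "algorithm \<Rightarrow> 'v port_graph \<Rightarrow> 'v \<times> nat \<Rightarrow> nat \<Rightarrow> 'v \<times> nat \<Rightarrow> nat \<Rightarrow> nat \<Rightarrow> bool" where
  "meet_at A G a1 \<tau>1 a2 \<tau>2 r \<longleftrightarrow> position A G a1 \<tau>1 r = position A G a2 \<tau>2 r"

definition is_instance :: "nat \<Rightarrow> 'v port_graph \<Rightarrow> 'v \<times> nat \<Rightarrow> 'v \<times> nat \<Rightarrow> bool" where
  "is_instance L G a1 a2 \<longleftrightarrow>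
     fst a1 \<in> nodes G \<and> fst a2 \<in> nodes G \<and> fst a1 \<noteq> fst a2 \<and>
     snd a1 \<in> {1..L} \<and> snd a2 \<in> {1..L} \<and> snd a1 \<noteq> snd a2"

text \<open>
  Rounds from the earlier wakeup to the first meeting (infinite if there is none), in the worst
  case over the wakeup times chosen by the adversary.
\<close>

definition rendezvous_time ::
  "algorithm \<Rightarrow> 'v port_graph \<Rightarrow> 'v \<times> nat \<Rightarrow> 'v \<times> nat \<Rightarrow> enat" where
  "rendezvous_time A G a1 a2 =
     (SUP (\<tau>1, \<tau>2) \<in> UNIV. INF r \<in> {r. meet_at A G a1 \<tau>1 a2 \<tau>2 r}. enat (r - min \<tau>1 \<tau>2))"

text \<open>
  All degrees are countable, so every connected graph has countably many nodes, and it
  is no restriction to take the nodes from the type of natural numbers.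
\<close>

definition universal_rendezvous :: "nat \<Rightarrow> algorithm \<Rightarrow> bool" where
  "universal_rendezvous L A \<longleftrightarrow>
     chooses_ports A \<and>
     (\<forall>(G :: nat port_graph) a1 a2 \<tau>1 \<tau>2.
        connected_port_graph G \<longrightarrow> is_instance L G a1 a2 \<longrightarrow> (\<exists>r. meet_at A G a1 \<tau>1 a2 \<tau>2 r))"

end

theory Submission
  imports Defs
begin

text \<open>
  Both lower bounds come from one graph, the infinite hypercube: nodes are finite sets of
  coordinates (coded as natural numbers in binary) and port \<open>p\<close> flips the coordinate \<open>p - 1\<close>.
  All nodes look alike, so the moves of an agent depend on its label only, and two nodes that
  differ in the coordinate \<open>m - 1\<close> alone have weight \<open>2 * m\<close>.

  If the second agent sleeps, the first one visits at most \<open>k\<close> nodes in \<open>k\<close> rounds, hence misses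
  one of any \<open>k + 1\<close> neighbours of its starting node. If both agents start together, then among
  more than \<open>2 ^ k\<close> labels two flip the coordinate \<open>m - 1\<close> in the same of the first \<open>k\<close> rounds,
  so two agents with these labels that initially differ in this coordinate still do after \<open>k\<close>
  rounds.
\<close>

unbundle bit_operations_syntax

text \<open>Both ends of an edge carry the same port number and all degrees are infinite, so
  percepts tell an agent nothing beyond its own moves. The shift \<open>p - 1\<close> is there
  because ports start at 1 and bits at 0.\<close>

definition cube :: "nat port_graph" where
  "cube = \<lparr>nodes = UNIV, degree = \<lambda>_. \<infinity>, rot = \<lambda>v p. (flip_bit (p - 1) v, p)\<rparr>"

lemma cube_simps [simp]:
  "nodes cube = UNIV" "degree cube v = \<infinity>" "rot cube v p = (flip_bit (p - 1) v, p)"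
  by (simp_all add: cube_def)

lemma ports_cube [simp]: "ports cube v = {1..}"
  by (auto simp: ports_def)

lemma bit_flip_bit_nat: "bit (flip_bit n (v::nat)) k \<longleftrightarrow> (if k = n then \<not> bit v k else bit v k)"
  by (auto simp: bit_simps)

lemma flip_bit_flip_bit_nat [simp]: "flip_bit n (flip_bit n (v::nat)) = v"
  by (rule bit_eqI) (simp add: bit_flip_bit_nat)

lemma flip_bit_neq_nat [simp]: "flip_bit n (v::nat) \<noteq> v"
  by (metis bit_flip_bit_nat)

lemma flip_bit_nat_inj: "flip_bit m (v::nat) = flip_bit n v \<Longrightarrow> m = n"
  by (metis bit_flip_bit_nat)

lemma finite_bits_nat: "finite {n. bit (w::nat) n}"
proof (rule finite_subset)
  show "{n. bit w n} \<subseteq> {..<w}"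
  proof (intro subsetI CollectI, rule ccontr)
    fix n assume n: "n \<in> {n. bit w n}" "n \<notin> {..<w}"
    then have "w < 2 ^ n" using le_less_trans[OF _ less_exp, of w n] by simp
    with n(1) show False by (simp add: bit_iff_odd)
  qed
qed simp

text \<open>Naturals have finitely many set bits, so \<open>u\<close> and \<open>v\<close> differ in
  finitely many coordinates; each step repairs one of them.\<close>

lemma cube_path_exists: "\<exists>\<pi>. is_path cube u \<pi> v"
proof (induction "card {n. bit u n \<noteq> bit v n}" arbitrary: u rule: less_induct)
  case less
  have fin: "finite {n. bit u n \<noteq> bit v n}"
    by (rule finite_subset[of _ "{n. bit u n} \<union> {n. bit v n}"]) (auto simp: finite_bits_nat)
  show ?case
  proof (cases "u = v")
    case True
    then have "is_path cube u [] v" by simp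
    then show ?thesis ..
  next
    case False
    then obtain k where k: "bit u k \<noteq> bit v k" by (metis bit_eqI)
    have "{n. bit (flip_bit k u) n \<noteq> bit v n} = {n. bit u n \<noteq> bit v n} - {k}"
      using k by (auto simp: bit_flip_bit_nat split: if_splits)
    then have "card {n. bit (flip_bit k u) n \<noteq> bit v n} < card {n. bit u n \<noteq> bit v n}"
      using card_Diff1_less[OF fin, of k] k by simp
    from less[OF this] obtain \<pi> where "is_path cube (flip_bit k u) \<pi> v" by blast
    then have "is_path cube u (Suc k # \<pi>) v" by simp
    then show ?thesis ..
  qed
qed

lemma connected_cube: "connected_port_graph cube"
  by (simp add: connected_port_graph_def is_port_graph_def cube_path_exists)

lemma cube_path_bit:
  assumes "is_path cube u \<pi> v" "Suc k \<notin> set \<pi>"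
  shows "bit v k = bit u k"
  using assms
proof (induction \<pi> arbitrary: u)
  case (Cons p \<pi>)
  then have "bit v k = bit (flip_bit (p - 1) u) k" "k \<noteq> p - 1" by auto
  then show ?case by (simp add: bit_flip_bit_nat)
qed simp

lemma type_value_ge:
  assumes "m \<in> set \<pi>"
  shows "2 * m \<le> type_value (path_type \<pi>)"
proof -
  define y where "y = length \<pi>"
  have y: "1 \<le> y" using assms by (cases \<pi>) (auto simp: y_def)
  have "m \<le> Max (set \<pi>)" using assms by simp
  also have "\<dots> \<le> Max (set \<pi>) ^ y" using y by (cases "Max (set \<pi>) = 0") (simp_all add: self_le_power)
  finally have "m \<le> Max (set \<pi>) ^ y" .
  moreover have "2 ^ 1 \<le> (2::nat) ^ y" using y by (intro power_increasing) auto
  ultimately have "(1 * 2) * m \<le> (y * 2 ^ y) * Max (set \<pi>) ^ y"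
    using y by (intro mult_mono) auto
  then show ?thesis by (simp add: type_value_def path_type_def y_def)
qed

text \<open>The single edge through port \<open>Suc k\<close> attains the value; conversely, no
  other port changes bit \<open>k\<close>, so every path uses this one.\<close>

lemma weight_cube: "weight cube u (flip_bit k u) = 2 * Suc k"
  unfolding weight_def
proof (rule Least_equality)
  show "\<exists>\<pi>. is_path cube u \<pi> (flip_bit k u) \<and> 2 * Suc k = type_value (path_type \<pi>)"
    by (rule exI[of _ "[Suc k]"]) (simp add: type_value_def path_type_def)
next
  fix w
  assume "\<exists>\<pi>. is_path cube u \<pi> (flip_bit k u) \<and> w = type_value (path_type \<pi>)"
  then obtain \<pi> where \<pi>: "is_path cube u \<pi> (flip_bit k u)" "w = type_value (path_type \<pi>)"
    by blast
  have "Suc k \<in> set \<pi>" using cube_path_bit[OF \<pi>(1), of k] by (auto simp: bit_flip_bit_nat)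
  then show "2 * Suc k \<le> w" unfolding \<pi>(2) by (rule type_value_ge)
qed

lemma pair_weight_cube: "pair_weight cube u (flip_bit k u) = 2 * Suc k"
  using weight_cube[of u k] weight_cube[of "flip_bit k u" k] by (simp add: pair_weight_def)

text \<open>The history is independent of the starting node, hence so are the actions, and flipping
  a coordinate commutes with XOR by \<open>v\<close>.\<close>

lemma run_cube_translate:
  "run A cube (v, l) t =
     (fst (run A cube (0, l) t), v XOR snd (run A cube (0, l) t))"
proof (induction t)
  case 0
  show ?case by simp
next
  case (Suc t)
  obtain h u where hu: "run A cube (0, l) t = (h, u)" by fastforce
  have "flip_bit n (v XOR u) = v XOR flip_bit n u" for n
    by (rule bit_eqI) (auto simp: bit_flip_bit_nat bit_xor_iff)
  with Suc hu show ?case by (auto split: action.split)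
qed

text \<open>One choice of wakeup times bounds the supremum from below. If the agents never meet, the
  infimum is over the empty set and hence infinite.\<close>

lemma rendezvous_time_ge:
  assumes "\<And>r. meet_at A G a1 \<tau>1 a2 \<tau>2 r \<Longrightarrow> n \<le> r - min \<tau>1 \<tau>2"
  shows "enat n \<le> rendezvous_time A G a1 a2"
proof -
  have "enat n \<le> (INF r \<in> {r. meet_at A G a1 \<tau>1 a2 \<tau>2 r}. enat (r - min \<tau>1 \<tau>2))"
    using assms by (intro INF_greatest) auto
  also have "\<dots> \<le> rendezvous_time A G a1 a2"
    unfolding rendezvous_time_def by (rule SUP_upper2[of "(\<tau>1, \<tau>2)"]) auto
  finally show ?thesis .
qed

text \<open>The neighbour that is missed depends on \<open>A\<close>; the set \<open>K\<close> of
  candidates serves to keep its weight in a prescribed range.\<close>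

lemma cube_time_sleeping:
  assumes "finite K" "T < card K"
  obtains k where "k \<in> K"
    "enat (Suc T) \<le> rendezvous_time A cube (v, l1) (flip_bit k v, l2)"
proof -
  define pos where "pos = (\<lambda>r. snd (run A cube (v, l1) r))"
  \<comment> \<open>Round 0 is left out: the agent is then at \<open>v\<close>, which is none of its
    own neighbours. So \<open>T + 1\<close> candidates suffice.\<close>
  have "card (pos ` {1..T}) \<le> T" using card_image_le[of "{1..T}" pos] by simp
  also have "T < card ((\<lambda>k. flip_bit k v) ` K)"
    using assms(2) by (subst card_image) (auto intro: inj_onI flip_bit_nat_inj)
  finally have "\<not> (\<lambda>k. flip_bit k v) ` K \<subseteq> pos ` {1..T}"
    by (meson card_mono finite_atLeastAtMost finite_imageI not_le)
  then obtain k where k: "k \<in> K" "flip_bit k v \<notin> pos ` {1..T}" by blast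
  have "enat (Suc T) \<le> rendezvous_time A cube (v, l1) (flip_bit k v, l2)"
  \<comment> \<open>Waking up at time \<open>T\<close>, the second agent is still at its starting
    node at every time up to \<open>T\<close>.\<close>
  proof (rule rendezvous_time_ge[where ?\<tau>1.0 = 0 and ?\<tau>2.0 = T])
    fix r
    assume "meet_at A cube (v, l1) 0 (flip_bit k v, l2) T r"
    then have meet: "pos r = snd (run A cube (flip_bit k v, l2) (r - T))"
      by (simp add: meet_at_def position_def pos_def)
    show "Suc T \<le> r - min 0 T"
    proof (rule ccontr)
      assume "\<not> Suc T \<le> r - min 0 T"
      then have "r \<le> T" by simp
      with meet have eq: "pos r = flip_bit k v" by simp
      then have "r \<noteq> 0" using flip_bit_neq_nat[of k v] by (intro notI) (simp add: pos_def)
      with \<open>r \<le> T\<close> have "r \<in> {1..T}" by simp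
      with eq k(2) show False by (metis imageI)
    qed
  qed
  with k(1) show ?thesis using that by blast
qed

lemma cube_time_labels:
  assumes "2 ^ T < L"
  obtains l1 l2 where "l1 \<in> {1..L}" "l2 \<in> {1..L}" "l1 \<noteq> l2"
    "enat (Suc T) \<le> rendezvous_time A cube (v, l1) (flip_bit k v, l2)"
proof -
  \<comment> \<open>Bit \<open>k\<close> is recorded after each round rather than its changes. At
    time 0 it is clear for every label, so only \<open>2 ^ T\<close> patterns are possible.\<close>
  define flips where "flips = (\<lambda>l. {r \<in> {1..T}. bit (snd (run A cube (0, l) r)) k})"
  have "card (flips ` {1..L}) \<le> card (Pow {1..T})"
    by (intro card_mono) (auto simp: flips_def)
  also have "\<dots> < card {1..L}" using assms by (simp add: card_Pow)
  finally have "\<not> inj_on flips {1..L}" by (metis card_image less_irrefl)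
  then obtain l1 l2 where l: "l1 \<in> {1..L}" "l2 \<in> {1..L}" "l1 \<noteq> l2" "flips l1 = flips l2"
    by (auto simp: inj_on_def)
  have same: "bit (snd (run A cube (0, l1) r)) k = bit (snd (run A cube (0, l2) r)) k"
    if "r \<le> T" for r
  proof (cases "r = 0")
    case False
    with that have "r \<in> {1..T}" by simp
    with l(4) show ?thesis unfolding flips_def by blast
  qed simp
  have "enat (Suc T) \<le> rendezvous_time A cube (v, l1) (flip_bit k v, l2)"
  proof (rule rendezvous_time_ge[where ?\<tau>1.0 = 0 and ?\<tau>2.0 = 0])
    fix r
    assume "meet_at A cube (v, l1) 0 (flip_bit k v, l2) 0 r"
    then have "v XOR snd (run A cube (0, l1) r) = flip_bit k v XOR snd (run A cube (0, l2) r)"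
      by (simp add: meet_at_def position_def run_cube_translate[of A v]
          run_cube_translate[of A "flip_bit k v"])
    then have "bit (snd (run A cube (0, l1) r)) k \<noteq> bit (snd (run A cube (0, l2) r)) k"
      by (metis bit_flip_bit_nat bit_xor_iff)
    with same[of r] show "Suc T \<le> r - min 0 0" by force
  qed
  with l(1-3) show ?thesis using that by blast
qed

theorem proposition3p1:
  "\<exists>c::real. c > 0 \<and>
     (\<forall>(L::nat) (A::algorithm). L \<ge> 2 \<longrightarrow> universal_rendezvous L A \<longrightarrow>
        (\<forall>B::nat. B \<ge> 1 \<longrightarrow>
           (\<exists>(G :: nat port_graph) v1 l1 v2 l2.
              connected_port_graph G \<and> is_instance L G (v1, l1) (v2, l2) \<and>
              B \<le> pair_weight G v1 v2 \<and> pair_weight G v1 v2 \<le> 2 * B \<and>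
              ereal (c * max (real (pair_weight G v1 v2)) (log 2 (real L)))
                \<le> ereal_of_enat (rendezvous_time A G (v1, l1) (v2, l2)))))"
proof (rule exI[of _ "1/4"], intro conjI allI impI)
  fix L :: nat and A :: algorithm and B :: nat
  assume L: "L \<ge> 2" and B: "B \<ge> 1"
  \<comment> \<open>The weight will be \<open>2 * Suc k\<close>, at most \<open>2 * B\<close>;
    bounding \<open>2 * B\<close> instead makes the case split independent of
    \<open>k\<close>.\<close>
  have "\<exists>k l1 l2 T. l1 \<in> {1..L} \<and> l2 \<in> {1..L} \<and> l1 \<noteq> l2 \<and>
      B \<le> 2 * Suc k \<and> Suc k \<le> B \<and> max (2 * real B) (log 2 (real L)) \<le> 4 * real (Suc T) \<and>
      enat (Suc T) \<le> rendezvous_time A cube (0, l1) (flip_bit k 0, l2)"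
  proof (cases "log 2 (real L) \<le> 2 * real B")
    case True
    \<comment> \<open>These are exactly the \<open>k\<close> with
      \<open>B \<le> 2 * Suc k \<le> 2 * B\<close>. There are \<open>B div 2 + 1\<close> of them,
      which yields about \<open>B / 2\<close> rounds and hence the constant 1/4.\<close>
    have "B div 2 < card {(B - 1) div 2..<B}" using B by simp
    from cube_time_sleeping[OF finite_atLeastLessThan this, of A 0 1 2]
    obtain k where k: "k \<in> {(B - 1) div 2..<B}"
      "enat (Suc (B div 2)) \<le> rendezvous_time A cube (0, 1) (flip_bit k 0, 2)" by blast
    have "real B \<le> real (2 * Suc (B div 2))" by (subst of_nat_le_iff) presburger
    then have "max (2 * real B) (log 2 (real L)) \<le> 4 * real (Suc (B div 2))" using True by simp
    moreover have "B \<le> 2 * Suc k" "Suc k \<le> B" using k(1) by auto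
    moreover have "(1::nat) \<in> {1..L}" "(2::nat) \<in> {1..L}" "(1::nat) \<noteq> 2" using L by auto
    ultimately show ?thesis using k(2) by blast
  next
    case False
    \<comment> \<open>The largest \<open>T\<close> for which the pigeonhole on labels works; the
      upper bound on \<open>L\<close> turns \<open>Suc T\<close> rounds into at least
      \<open>log 2 L\<close>.\<close>
    obtain T where T: "2 ^ T < L" "L \<le> 2 ^ Suc T"
      using ex_power_ivl2[of 2 L] L by auto
    obtain l1 l2 where l: "l1 \<in> {1..L}" "l2 \<in> {1..L}" "l1 \<noteq> l2"
      "enat (Suc T) \<le> rendezvous_time A cube (0, l1) (flip_bit (B - 1) 0, l2)"
      using cube_time_labels[OF T(1), of A 0 "B - 1"] by blast
    have "real L \<le> real (2 ^ Suc T)" using T(2) by (simp only: of_nat_le_iff)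
    also have "\<dots> = 2 powr real (Suc T)" by (simp add: powr_realpow del: power_Suc of_nat_Suc)
    finally have "log 2 (real L) \<le> real (Suc T)"
      using L by (subst log_le_iff) (simp_all del: of_nat_Suc)
    then have "max (2 * real B) (log 2 (real L)) \<le> 4 * real (Suc T)" using False by simp
    moreover have "B \<le> 2 * Suc (B - 1)" "Suc (B - 1) \<le> B" using B by auto
    ultimately show ?thesis using l by blast
  qed
  then obtain k l1 l2 T where *: "l1 \<in> {1..L}" "l2 \<in> {1..L}" "l1 \<noteq> l2"
      "B \<le> 2 * Suc k" "Suc k \<le> B" "max (2 * real B) (log 2 (real L)) \<le> 4 * real (Suc T)"
      "enat (Suc T) \<le> rendezvous_time A cube (0, l1) (flip_bit k 0, l2)" by blast
  let ?v2 = "flip_bit k 0 :: nat"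
  have W: "pair_weight cube 0 ?v2 = 2 * Suc k" by (rule pair_weight_cube)
  have "ereal (1/4 * max (real (pair_weight cube 0 ?v2)) (log 2 (real L)))
      \<le> ereal_of_enat (enat (Suc T))"
    unfolding W using *(5,6) by auto
  also have "\<dots> \<le> ereal_of_enat (rendezvous_time A cube (0, l1) (?v2, l2))"
    using *(7) by (simp only: ereal_of_enat_le_iff)
  finally have "ereal (1/4 * max (real (pair_weight cube 0 ?v2)) (log 2 (real L)))
      \<le> ereal_of_enat (rendezvous_time A cube (0, l1) (?v2, l2))" .
  moreover have "is_instance L cube (0, l1) (?v2, l2)"
    using *(1-3) by (auto simp: is_instance_def dest: sym)
  moreover have "B \<le> pair_weight cube 0 ?v2" "pair_weight cube 0 ?v2 \<le> 2 * B"
    unfolding W using *(4,5) by auto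
  ultimately show "\<exists>(G :: nat port_graph) v1 l1 v2 l2.
      connected_port_graph G \<and> is_instance L G (v1, l1) (v2, l2) \<and>
      B \<le> pair_weight G v1 v2 \<and> pair_weight G v1 v2 \<le> 2 * B \<and>
      ereal (1/4 * max (real (pair_weight G v1 v2)) (log 2 (real L)))
        \<le> ereal_of_enat (rendezvous_time A G (v1, l1) (v2, l2))"
    using connected_cube by blast
qed simp

end
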